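(* There are fine ultrafilters $\mathcal{U}$ on $[V]^{<\omega}$ such that $\mathsf{Pr}_{\mathcal{U}}$ is superregular, i.e. for every diagonal random variable $\theta$ and all classes $A,B\subseteq V$ with $\omega\leq|A|<|B|\leq|V|$, we have $\mathsf{Pr}_{\mathcal{U}}(\theta\in A)\ll\mathsf{Pr}_{\mathcal{U}}(\theta\in B)$.
   Context: $V$ is the set-theoretic universe; $[V]^{<\omega}$ is the collection of finite subsets of $V$; cardinalities of classes are compared in the usual way, a proper class having size $|V|$, larger than that of any set. An ultrafilter $\mathcal{U}$ on $[V]^{<\omega}$ is fine if for every $x\in V$, $\{T\in[V]^{<\omega}: x\in T\}\in\mathcal{U}$. Functions $[V]^{<\omega}\to\mathbb{Q}$ modulo agreement on a set in $\mathcal{U}$ form an ordered hyper-rational field $\mathcal{F}_{\mathcal{U}}$. A random variable is a class function $\tau:V\to V$; it is diagonal if every set is the value of $\tau$ at exactly one argument. For a class $A$, $\mathsf{Pr}_{\mathcal{U}}(\tau\in A)=[T\mapsto |\{s\in T:\tau(s)\in A\}|/|T|]_{\mathcal{U}}$. For $p,q\in\mathcal{F}_{\mathcal{U}}$ with $q>0$, $p\ll q$ means $p/q<1/n$ for every positive integer $n$. *)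

theory Defs
  imports Main "HOL-Library.FSet" "HOL.Rat"
begin

unbundle cardinal_syntax

text \<open>
  The universe of sets is a type \<open>'v\<close> whose elements are the sets; \<open>elts x\<close> is the collection of
  members of \<open>x\<close>. Classes are arbitrary terms of type \<open>'v set\<close>, and a class \<open>X\<close> is a set
  iff \<open>X = elts x\<close> for some \<open>x\<close>. Limitation of size states that the proper classes are
  exactly the classes of the cardinality of the universe, and that every set is smaller than
  that; it subsumes separation and replacement (see below) and the axiom of choice.
\<close>

locale set_universe =
  fixes elts :: "'v \<Rightarrow> 'v set"
  assumes extensionality: "elts x = elts y \<Longrightarrow> x = y"
    and foundation: "X \<noteq> {} \<Longrightarrow> \<exists>x\<in>X. elts x \<inter> X = {}"
    and pairing: "\<exists>z. elts z = {x, y}"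
    and union: "\<exists>u. elts u = (\<Union>y\<in>elts x. elts y)"
    and power_set: "\<exists>p. elts p = {y. elts y \<subseteq> elts x}"
    and infinity: "\<exists>w. (\<exists>e\<in>elts w. elts e = {}) \<and>
                       (\<forall>x\<in>elts w. \<exists>s\<in>elts w. elts s = insert x (elts x))"
    and limitation_of_size: "(\<exists>x. elts x = X) \<longleftrightarrow> |X| <o |UNIV :: 'v set|"
begin

lemma separation: "\<exists>y. elts y = {z \<in> elts x. P z}"
proof -
  have "|elts x| <o |UNIV :: 'v set|"
    using limitation_of_size by blast
  moreover have "|{z \<in> elts x. P z}| \<le>o |elts x|"
    by (rule card_of_mono1) auto
  ultimately show ?thesis
    using limitation_of_size ordLeq_ordLess_trans by blast
qed

lemma replacement: "\<exists>y. elts y = F ` elts x"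
proof -
  have "|elts x| <o |UNIV :: 'v set|"
    using limitation_of_size by blast
  moreover have "|F ` elts x| \<le>o |elts x|"
    by (rule card_of_image)
  ultimately show ?thesis
    using limitation_of_size ordLeq_ordLess_trans by blast
qed

lemma proper_class_size:
  assumes "\<nexists>x. elts x = X"
  shows "|X| =o |UNIV :: 'v set|"
proof -
  have "\<not> |X| <o |UNIV :: 'v set|"
    using assms limitation_of_size by blast
  then have "|UNIV :: 'v set| \<le>o |X|"
    using not_ordLess_iff_ordLeq[OF card_of_Well_order card_of_Well_order] by blast
  moreover have "|X| \<le>o |UNIV :: 'v set|"
    by (rule card_of_mono1) simp
  ultimately show ?thesis
    by (simp add: ordIso_iff_ordLeq)
qed

end

definition ultrafilter :: "'a filter \<Rightarrow> bool" where
  "ultrafilter F \<longleftrightarrow> F \<noteq> bot \<and> (\<forall>P. eventually P F \<or> eventually (\<lambda>x. \<not> P x) F)"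

definition fine :: "'v fset filter \<Rightarrow> bool" where
  "fine U \<longleftrightarrow> (\<forall>x. eventually (\<lambda>T. x |\<in>| T) U)"

text \<open>The hyper-rationals \<open>\<F>\<^sub>U\<close>: rational functions on finite subsets modulo \<open>U\<close>,
  with the operations induced from representatives.\<close>

definition hyprel :: "'i filter \<Rightarrow> (('i \<Rightarrow> rat) \<times> ('i \<Rightarrow> rat)) set" where
  "hyprel U = {(f, g). eventually (\<lambda>T. f T = g T) U}"

definition hyper :: "'i filter \<Rightarrow> ('i \<Rightarrow> rat) \<Rightarrow> ('i \<Rightarrow> rat) set" where
  "hyper U f = hyprel U `` {f}"

definition hyper_of_rat :: "'i filter \<Rightarrow> rat \<Rightarrow> ('i \<Rightarrow> rat) set" where
  "hyper_of_rat U r = hyper U (\<lambda>_. r)"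

definition hyper_less :: "'i filter \<Rightarrow> ('i \<Rightarrow> rat) set \<Rightarrow> ('i \<Rightarrow> rat) set \<Rightarrow> bool" where
  "hyper_less U p q \<longleftrightarrow> (\<exists>f\<in>p. \<exists>g\<in>q. eventually (\<lambda>T. f T < g T) U)"

definition hyper_divide ::
  "'i filter \<Rightarrow> ('i \<Rightarrow> rat) set \<Rightarrow> ('i \<Rightarrow> rat) set \<Rightarrow> ('i \<Rightarrow> rat) set" where
  "hyper_divide U p q = (\<Union>f\<in>p. \<Union>g\<in>q. hyper U (\<lambda>T. f T / g T))"

lemma equiv_hyprel: "equiv UNIV (hyprel U)"
  unfolding equiv_def refl_on_def sym_def trans_def hyprel_def
  by (auto elim: eventually_mono eventually_elim2)

lemma hyper_eq_iff: "hyper U f = hyper U g \<longleftrightarrow> eventually (\<lambda>T. f T = g T) U"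
  using eq_equiv_class_iff[OF equiv_hyprel] by (simp add: hyper_def hyprel_def)

lemma mem_hyper_iff: "g \<in> hyper U f \<longleftrightarrow> eventually (\<lambda>T. f T = g T) U"
  by (simp add: hyper_def hyprel_def)

lemma hyper_less_hyper [simp]:
  "hyper_less U (hyper U f) (hyper U g) \<longleftrightarrow> eventually (\<lambda>T. f T < g T) U"
proof
  assume "hyper_less U (hyper U f) (hyper U g)"
  then obtain f' g' where "eventually (\<lambda>T. f T = f' T) U" "eventually (\<lambda>T. g T = g' T) U"
    "eventually (\<lambda>T. f' T < g' T) U"
    by (auto simp: hyper_less_def mem_hyper_iff)
  then show "eventually (\<lambda>T. f T < g T) U"
    by eventually_elim simp
next
  assume "eventually (\<lambda>T. f T < g T) U"
  moreover have "f \<in> hyper U f" "g \<in> hyper U g"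
    by (simp_all add: mem_hyper_iff)
  ultimately show "hyper_less U (hyper U f) (hyper U g)"
    unfolding hyper_less_def by blast
qed

lemma hyper_divide_hyper [simp]:
  "hyper_divide U (hyper U f) (hyper U g) = hyper U (\<lambda>T. f T / g T)"
proof -
  have "hyper U (\<lambda>T. f' T / g' T) = hyper U (\<lambda>T. f T / g T)"
    if "f' \<in> hyper U f" "g' \<in> hyper U g" for f' g'
    using that unfolding mem_hyper_iff hyper_eq_iff by eventually_elim simp
  moreover have "f \<in> hyper U f" "g \<in> hyper U g"
    by (simp_all add: mem_hyper_iff)
  ultimately show ?thesis
    unfolding hyper_divide_def by blast
qed

text \<open>The relation \<open>p \<lless> q\<close>, which presupposes \<open>q > 0\<close>.\<close>

definition hyper_much_less :: "'i filter \<Rightarrow> ('i \<Rightarrow> rat) set \<Rightarrow> ('i \<Rightarrow> rat) set \<Rightarrow> bool" where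
  "hyper_much_less U p q \<longleftrightarrow> hyper_less U (hyper_of_rat U 0) q \<and>
     (\<forall>n::nat. n > 0 \<longrightarrow> hyper_less U (hyper_divide U p q) (hyper_of_rat U (1 / of_nat n)))"

text \<open>For \<open>T = {||}\<close> the quotient is \<open>0\<close> by convention; this is immaterial for fine \<open>U\<close>.\<close>

definition Pr :: "'v fset filter \<Rightarrow> ('v \<Rightarrow> 'v) \<Rightarrow> 'v set \<Rightarrow> ('v fset \<Rightarrow> rat) set" where
  "Pr U \<tau> A = hyper U (\<lambda>T. of_nat (card {s \<in> fset T. \<tau> s \<in> A}) / of_nat (card (fset T)))"

definition diagonal :: "('v \<Rightarrow> 'v) \<Rightarrow> bool" where
  "diagonal \<tau> \<longleftrightarrow> (\<forall>x. \<exists>!s. \<tau> s = x)"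

definition superregular :: "'v fset filter \<Rightarrow> bool" where
  "superregular U \<longleftrightarrow>
     (\<forall>\<theta> A B. diagonal \<theta> \<longrightarrow>
        natLeq \<le>o |A| \<longrightarrow> |A| <o |B| \<longrightarrow> |B| \<le>o |UNIV :: 'v set| \<longrightarrow>
        hyper_much_less U (Pr U \<theta> A) (Pr U \<theta> B))"

end

(*
  A diagonal random variable is a bijection and so preserves cardinalities; hence superregularity
  only asks that n * card (T \<inter> A) < card (T \<inter> B) for U-almost all T, whenever A is smaller than an
  infinite B. By fineness and Zorn it suffices to meet finitely many such conditions, together with
  F \<subseteq> T for a finite F, at once. Treat the pairs (A, B) in increasing order of the size of B: when B
  is reached, all the sets A seen so far are smaller than B, so arbitrarily many points of B outside
  all of them can be added to T. This leaves every T \<inter> A unchanged, and no T \<inter> B shrinks.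
*)
theory Submission
  imports Defs
begin

section \<open>Ultrafilters from Zorn's lemma and the finite intersection property\<close>

text \<open>In the order on filters the finer filter is the smaller one, so ultrafilters are the
  minimal proper filters and Zorn's lemma is applied to the reversed order.\<close>

lemma ultrafilter_extends:
  assumes "F \<noteq> bot"
  shows "\<exists>U\<le>F. ultrafilter U"
proof -
  let ?A = "{G. G \<noteq> bot \<and> G \<le> F}"
  have "\<exists>U\<in>?A. \<forall>G\<in>?A. G \<le> U \<longrightarrow> G = U"
  proof (rule predicate_Zorn[where P = "\<lambda>G H. H \<le> G"])
    show "partial_order_on ?A (relation_of (\<lambda>G H. H \<le> G) ?A)"
      by (rule partial_order_on_relation_ofI) auto
  next
    fix C assume "C \<in> Chains (relation_of (\<lambda>G H. H \<le> G) ?A)"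
    then have C: "C \<subseteq> ?A" and chain: "G \<le> H \<or> H \<le> G" if "G \<in> C" "H \<in> C" for G H
      using that by (auto simp: Chains_def relation_of_def)
    show "\<exists>U\<in>?A. \<forall>G\<in>C. U \<le> G"
    proof (cases "C = {}")
      \<comment> \<open>\<open>Inf {}\<close> is \<open>top\<close>, which need not lie below
        \<open>F\<close>, so \<open>F\<close> itself bounds the empty chain.\<close>
      case True
      then show ?thesis
        using assms by blast
    next
      case False
      \<comment> \<open>A chain is directed downwards, so a property holding eventually in
        \<open>Inf C\<close> does so in a single member. If \<open>Inf C\<close> were
        \<open>bot\<close>, some member would be \<open>bot\<close>.\<close>
      have "eventually P (Inf C) \<longleftrightarrow> (\<exists>G\<in>C. eventually P G)" for P
        by (rule eventually_Inf_base[OF False]) (metis chain inf.absorb1 inf.absorb2)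
      then have "Inf C \<noteq> bot"
        using C by (auto simp: trivial_limit_def)
      moreover have "Inf C \<le> F"
        using False C by (auto intro: Inf_lower2)
      ultimately show ?thesis
        by (auto intro: Inf_lower)
    qed
  qed
  then obtain U where U: "U \<noteq> bot" "U \<le> F" and minimal: "\<And>G. G \<noteq> bot \<Longrightarrow> G \<le> U \<Longrightarrow> G = U"
    by (auto intro: order_trans)
  have "eventually P U \<or> eventually (\<lambda>x. \<not> P x) U" for P
  \<comment> \<open>Adjoining \<open>P\<close> to \<open>U\<close> either is contradictory, so the
    negation of \<open>P\<close> holds eventually, or yields a proper filter below \<open>U\<close>,
    which is \<open>U\<close> by minimality.\<close>
  proof (cases "inf U (principal {x. P x}) = bot")
    case True
    then show ?thesis
      by (simp add: trivial_limit_def eventually_inf_principal)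
  next
    case False
    then have "inf U (principal {x. P x}) = U"
      by (simp add: minimal)
    then have "U \<le> principal {x. P x}"
      by (metis inf.cobounded2)
    then show ?thesis
      by (simp add: le_principal)
  qed
  then show ?thesis
    using U by (auto simp: ultrafilter_def)
qed

lemma ultrafilter_finite_intersection:
  assumes "\<And>X. X \<subseteq> \<S> \<Longrightarrow> finite X \<Longrightarrow> \<Inter>X \<noteq> {}"
  shows "\<exists>U. ultrafilter U \<and> (\<forall>S\<in>\<S>. eventually (\<lambda>x. x \<in> S) U)"
proof -
  have "(INF S\<in>\<S>. principal S) \<noteq> bot"
  proof (rule INF_filter_not_bot)
    fix X assume "X \<subseteq> \<S>" "finite X"
    then show "(INF S\<in>X. principal S) \<noteq> bot"
      using assms[of X] INF_principal_finite[of X "\<lambda>S. S"] by (simp add: principal_eq_bot_iff)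
  qed
  then obtain U where U: "ultrafilter U" "U \<le> (INF S\<in>\<S>. principal S)"
    using ultrafilter_extends by blast
  then have "eventually (\<lambda>x. x \<in> S) U" if "S \<in> \<S>" for S
    using that by (auto simp: le_INF_iff le_principal)
  then show ?thesis
    using U by blast
qed

section \<open>Cardinal comparisons\<close>

lemma card_of_finite_ordLess_infinite:
  assumes "finite A" "infinite B"
  shows "|A| <o |B|"
  using assms finite_ordLess_infinite[OF card_of_Well_order card_of_Well_order, of A B]
  unfolding Field_card_of by blast

lemma card_of_UNION_finite_ordLess:
  assumes "finite I" "infinite B" "\<And>i. i \<in> I \<Longrightarrow> |A i| <o |B|"
  shows "|\<Union>i\<in>I. A i| <o |B|"
  using assms(1,3)
proof (induction I)
  case empty
  then show ?case
    using assms(2) by (simp add: card_of_finite_ordLess_infinite)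
next
  case (insert i I)
  then show ?case
    using assms(2) by (simp add: card_of_Un_ordLess_infinite)
qed

text \<open>Otherwise \<open>A\<close> and \<open>B - A\<close> would be two sets smaller than the
  infinite \<open>B\<close> that together cover it.\<close>

lemma infinite_Diff_card_of_ordLess:
  assumes "infinite B" "|A| <o |B|"
  shows "infinite (B - A)"
proof
  assume "finite (B - A)"
  then have "|B - A| <o |B|"
    using assms(1) by (rule card_of_finite_ordLess_infinite)
  then have "|A \<union> (B - A)| <o |B|"
    using assms by (intro card_of_Un_ordLess_infinite)
  moreover have "|B| \<le>o |A \<union> (B - A)|"
    by (rule card_of_mono1) auto
  ultimately show False
    using not_ordLess_ordLeq by blast
qed

lemma finite_has_largest_card_of:
  assumes "finite I" "I \<noteq> {}"
  shows "\<exists>i\<in>I. \<forall>j\<in>I. |B j| \<le>o |B i|"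
  using assms
proof (induction I rule: finite_ne_induct)
  case (singleton i)
  then show ?case
    by (auto intro: card_of_mono1)
next
  case (insert i I)
  then obtain k where k: "k \<in> I" "\<forall>j\<in>I. |B j| \<le>o |B k|"
    by blast
  have "|B i| \<le>o |B k| \<or> |B k| \<le>o |B i|"
    by (rule ordLeq_total[OF card_of_Well_order card_of_Well_order])
  then show ?case
  proof
    assume "|B i| \<le>o |B k|"
    then show ?thesis
      using k by auto
  next
    assume "|B k| \<le>o |B i|"
    then have "|B j| \<le>o |B i|" if "j \<in> I" for j
      using k(2) that ordLeq_transitive by blast
    then show ?thesis
      by (auto intro: card_of_mono1)
  qed
qed

section \<open>Meeting finitely many domination conditions, then all of them\<close>

lemma finite_set_dominating:
  assumes "finite I" "finite F"
    and "\<And>i. i \<in> I \<Longrightarrow> infinite (B i)" "\<And>i. i \<in> I \<Longrightarrow> |A i| <o |B i|"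
  shows "\<exists>T. finite T \<and> F \<subseteq> T \<and> (\<forall>i\<in>I. n i * card (T \<inter> A i) < card (T \<inter> B i))"
  using assms(1,3,4)
\<comment> \<open>The induction is on the size of \<open>I\<close> because the index split off must
  be one with a largest \<open>B i\<close>, not an arbitrary one.\<close>
proof (induction "card I" arbitrary: I)
  case 0
  then show ?case
    using assms(2) by auto
next
  case (Suc k)
  then have "I \<noteq> {}"
    by auto
  then obtain m where m: "m \<in> I" and largest: "\<And>i. i \<in> I \<Longrightarrow> |B i| \<le>o |B m|"
    using finite_has_largest_card_of[OF Suc.prems(1)] by blast
  have "\<exists>T. finite T \<and> F \<subseteq> T \<and> (\<forall>i\<in>I - {m}. n i * card (T \<inter> A i) < card (T \<inter> B i))"
    using Suc m by (intro Suc.hyps(1)) auto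
  then obtain T where T: "finite T" "F \<subseteq> T"
    and dom: "\<And>i. i \<in> I \<Longrightarrow> i \<noteq> m \<Longrightarrow> n i * card (T \<inter> A i) < card (T \<inter> B i)"
    by blast
  \<comment> \<open>Each \<open>A i\<close> is smaller than \<open>B i\<close>, hence than
    \<open>B m\<close>, and a finite union of sets smaller than an infinite set stays
    smaller.\<close>
  have "|\<Union>i\<in>I. A i| <o |B m|"
    using Suc.prems m largest ordLess_ordLeq_trans by (intro card_of_UNION_finite_ordLess) blast+
  then have "infinite (B m - (\<Union>i\<in>I. A i))"
    using Suc.prems(2) m by (simp add: infinite_Diff_card_of_ordLess)
  \<comment> \<open>\<open>T \<inter> A m\<close> has at most \<open>card T\<close> points, and
    \<open>Suc\<close> makes the inequality for \<open>m\<close> strict.\<close>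
  then obtain S where S: "S \<subseteq> B m - (\<Union>i\<in>I. A i)" "finite S" "card S = Suc (n m * card T)"
    using infinite_arbitrarily_large[of _ "Suc (n m * card T)"] by metis
  have "n i * card ((T \<union> S) \<inter> A i) < card ((T \<union> S) \<inter> B i)" if i: "i \<in> I" for i
  proof -
    have A: "(T \<union> S) \<inter> A i = T \<inter> A i"
      using S(1) i by blast
    show ?thesis
    proof (cases "i = m")
      case True
      have "n m * card (T \<inter> A m) \<le> n m * card T"
        using T(1) by (simp add: card_mono)
      also have "\<dots> < card S"
        using S(3) by simp
      also have "\<dots> \<le> card ((T \<union> S) \<inter> B m)"
        using T(1) S(1,2) by (intro card_mono) auto
      finally show ?thesis
        using A True by simp
    next
      case False
      have "card (T \<inter> B i) \<le> card ((T \<union> S) \<inter> B i)"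
        using T(1) S(2) by (intro card_mono) auto
      then show ?thesis
        using A dom[OF i False] by simp
    qed
  qed
  then show ?case
    using T S(2) by (intro exI[of _ "T \<union> S"]) auto
qed

text \<open>The sets \<open>?f x\<close> express fineness and the sets \<open>?g (A, B, n)\<close>
  express domination. Finitely many of them share a point by \<open>finite_set_dominating\<close>,
  so one ultrafilter contains them all.\<close>

lemma dominating_ultrafilter:
  "\<exists>U :: 'v fset filter. ultrafilter U \<and> fine U \<and>
    (\<forall>A B n. infinite B \<longrightarrow> |A| <o |B| \<longrightarrow>
      eventually (\<lambda>T. n * card (fset T \<inter> A) < card (fset T \<inter> B)) U)"
proof -
  let ?f = "\<lambda>x. {T. x |\<in>| T}"
  let ?Q = "{(A, B, n). infinite B \<and> |A| <o |B| } :: ('v set \<times> 'v set \<times> nat) set"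
  let ?g = "\<lambda>(A, B, n). {T. n * card (fset T \<inter> A) < card (fset T \<inter> B)}"
  have "\<Inter>X \<noteq> {}" if X: "X \<subseteq> range ?f \<union> ?g ` ?Q" "finite X" for X
  proof -
    \<comment> \<open>\<open>X\<close> is a family of sets of either form, so finitely many indices
      \<open>F\<close> and \<open>I\<close> producing it are recovered first.\<close>
    obtain F where F: "finite F" "X \<inter> range ?f = ?f ` F"
      using finite_subset_image[of "X \<inter> range ?f" ?f UNIV] X(2) by auto
    obtain I where I: "finite I" "I \<subseteq> ?Q" "X \<inter> ?g ` ?Q = ?g ` I"
      using finite_subset_image[of "X \<inter> ?g ` ?Q" ?g ?Q] X(2) by auto
    obtain T where T: "finite T" "F \<subseteq> T"
      "\<And>i. i \<in> I \<Longrightarrow> snd (snd i) * card (T \<inter> fst i) < card (T \<inter> fst (snd i))"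
      using finite_set_dominating[of I F "\<lambda>i. fst (snd i)" fst "\<lambda>i. snd (snd i)"] F(1) I(1,2)
      by fastforce
    have "X = X \<inter> range ?f \<union> X \<inter> ?g ` ?Q"
      using X(1) by (simp only: Int_Un_distrib[symmetric] Int_absorb2)
    then have "X = ?f ` F \<union> ?g ` I"
      by (simp only: F(2) I(3))
    then have "Abs_fset T \<in> \<Inter>X"
      using T by (force simp: Abs_fset_inverse)
    then show ?thesis
      by blast
  qed
  then obtain U where U: "ultrafilter U"
      "\<And>S. S \<in> range ?f \<union> ?g ` ?Q \<Longrightarrow> eventually (\<lambda>T. T \<in> S) U"
    using ultrafilter_finite_intersection[of "range ?f \<union> ?g ` ?Q"] by blast
  have "fine U"
    using U(2)[of "?f _"] by (simp add: fine_def)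
  moreover have "eventually (\<lambda>T. n * card (fset T \<inter> A) < card (fset T \<inter> B)) U"
    if "infinite B" "|A| <o |B|" for A B n
  proof -
    have "?g (A, B, n) \<in> range ?f \<union> ?g ` ?Q"
      using that by blast
    from U(2)[OF this] show ?thesis
      by simp
  qed
  ultimately show ?thesis
    using U(1) by blast
qed

section \<open>From domination to superregularity\<close>

lemma card_of_vimage_diagonal:
  assumes "diagonal \<theta>"
  shows "|\<theta> -` A| =o |A|"
proof -
  have "bij_betw \<theta> (\<theta> -` A) A"
    using assms unfolding diagonal_def by (intro bij_betwI') (simp, metis, simp, metis vimageI)
  then show ?thesis
    using card_of_ordIso by blast
qed

lemma superregularI:
  assumes dom: "\<And>A B n. infinite B \<Longrightarrow> |A| <o |B| \<Longrightarrow>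
    eventually (\<lambda>T. n * card (fset T \<inter> A) < card (fset T \<inter> B)) U"
  shows "superregular U"
  unfolding superregular_def
proof (intro allI impI)
  fix \<theta> :: "'a \<Rightarrow> 'a" and A B :: "'a set"
  assume \<theta>: "diagonal \<theta>" and A: "natLeq \<le>o |A|" and AB: "|A| <o |B|"
  let ?A = "\<theta> -` A" and ?B = "\<theta> -` B"
  have "natLeq \<le>o |?B|"
    using A AB card_of_vimage_diagonal[OF \<theta>, of B]
    by (meson ordIso_symmetric ordLeq_ordIso_trans ordLess_imp_ordLeq ordLeq_transitive)
  then have inf: "infinite ?B"
    using infinite_iff_natLeq_ordLeq by blast
  have less: "|?A| <o |?B|"
    using AB card_of_vimage_diagonal[OF \<theta>]
    by (meson ordIso_ordLess_trans ordIso_symmetric ordLess_ordIso_trans)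
  have eq: "{s \<in> fset T. \<theta> s \<in> X} = fset T \<inter> \<theta> -` X" for T X
    by auto
  have size: "card (fset T \<inter> X) > 0 \<Longrightarrow> card (fset T) > 0" for T :: "'a fset" and X
    by (auto simp: card_gt_0_iff)
  have "eventually (\<lambda>T. (0::rat) <
      of_nat (card (fset T \<inter> ?B)) / of_nat (card (fset T))) U"
    \<comment> \<open>With factor 0 the domination says just that \<open>T\<close> meets
      \<open>?B\<close>, which makes both numerator and denominator positive.\<close>
    using dom[OF inf less, of 0] by eventually_elim (use size in auto)
  moreover have "eventually (\<lambda>T.
      (of_nat (card (fset T \<inter> ?A)) / of_nat (card (fset T))) /
      (of_nat (card (fset T \<inter> ?B)) / of_nat (card (fset T))) < (1 / of_nat n :: rat)) U"
    if "n > 0" for n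
    using dom[OF inf less, of n]
  proof eventually_elim
    case (elim T)
    then have pos: "card (fset T \<inter> ?B) > 0" "card (fset T) > 0" "fset T \<noteq> {}"
      using size[of T ?B] by auto
    have "(of_nat (n * card (fset T \<inter> ?A)) :: rat) < of_nat (card (fset T \<inter> ?B))"
      using elim by (simp only: of_nat_less_iff)
    then show ?case
      using pos \<open>n > 0\<close> by (simp add: field_simps)
  qed
  ultimately show "hyper_much_less U (Pr U \<theta> A) (Pr U \<theta> B)"
    by (simp add: hyper_much_less_def Pr_def hyper_of_rat_def eq)
qed

theorem theorem1:
  fixes elts :: "'v \<Rightarrow> 'v set"
  assumes "set_universe elts"
  shows "\<exists>U :: 'v fset filter. ultrafilter U \<and> fine U \<and> superregular U"
proof -
  obtain U :: "'v fset filter" where "ultrafilter U" "fine U"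
    "\<And>A B n. infinite B \<Longrightarrow> |A| <o |B| \<Longrightarrow>
      eventually (\<lambda>T. n * card (fset T \<inter> A) < card (fset T \<inter> B)) U"
    using dominating_ultrafilter by blast
  then show ?thesis
    using superregularI by blast
qed

end
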